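(* Let $d\ge 1$, $T>0$, and let $H:\mathbb{R}^d\times\mathbb{R}^d\to\mathbb{R}$ and $G:\mathbb{R}^d\to\mathbb{R}$ satisfy the standing assumptions given in the context. Let $\alpha\in\mathbb{R}$ and define $$H_\alpha(x,p):=H(x,p-\alpha x),\qquad G_\alpha(x):=G(x)+\frac{\alpha}{2}|x|^2 .$$ Then $u$ is a classical solution on $(0,T)\times\mathbb{R}^d$ to $$-\partial_t u(t,x)+H(x,\partial_x u(t,x))=0,\qquad u(T,x)=G(x),$$ if and only if the function $$u_\alpha(t,x):=u(t,x)+\frac{\alpha}{2}|x|^2$$ is a classical solution on $(0,T)\times\mathbb{R}^d$ to $$-\partial_t u_\alpha(t,x)+H_\alpha(x,\partial_x u_\alpha(t,x))=0,\qquad u_\alpha(T,x)=G_\alpha(x).$$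
   Context: Standing assumptions: $H\in C^2(\mathbb{R}^d\times\mathbb{R}^d)$ and $G\in C^2(\mathbb{R}^d)$ have uniformly bounded second derivatives; $H$ is convex in its second variable and $H(x,p)=\sup_{v\in\mathbb{R}^d}\{p\cdot v-L(x,-v)\}$ for some $L\in C^2(\mathbb{R}^d\times\mathbb{R}^d)$ that is convex in its second variable. Here $\partial_x$ denotes the gradient in $x\in\mathbb{R}^d$. A classical solution on $(0,T)\times\mathbb{R}^d$ of the terminal value problem is a function that is continuous on $(0,T]\times\mathbb{R}^d$, continuously differentiable on $(0,T)\times\mathbb{R}^d$, satisfies the equation pointwise on $(0,T)\times\mathbb{R}^d$, and satisfies the terminal condition at $t=T$ for all $x\in\mathbb{R}^d$. *)

theory Defs
  imports "HOL-Analysis.Analysis"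
begin

text \<open>Intended for open \<open>S\<close>: the derivatives are the unrestricted ones.\<close>

definition C1_on :: "'a::real_normed_vector set \<Rightarrow> ('a \<Rightarrow> 'b::real_normed_vector) \<Rightarrow> bool" where
  "C1_on S f \<longleftrightarrow>
     (\<exists>f' :: 'a \<Rightarrow> 'a \<Rightarrow>\<^sub>L 'b.
        (\<forall>x\<in>S. (f has_derivative blinfun_apply (f' x)) (at x)) \<and> continuous_on S f')"

text \<open>The second derivative of \<open>f\<close> is the derivative of \<open>f'\<close>, regarded as a map into the
  space of bounded linear maps.\<close>

definition has_derivatives2 ::
  "('a::real_normed_vector \<Rightarrow> 'b::real_normed_vector) \<Rightarrow>
   ('a \<Rightarrow> 'a \<Rightarrow>\<^sub>L 'b) \<Rightarrow> ('a \<Rightarrow> 'a \<Rightarrow>\<^sub>L 'a \<Rightarrow>\<^sub>L 'b) \<Rightarrow> bool" where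
  "has_derivatives2 f f' f'' \<longleftrightarrow>
     (\<forall>x. (f has_derivative blinfun_apply (f' x)) (at x)) \<and>
     (\<forall>x. (f' has_derivative blinfun_apply (f'' x)) (at x))"

definition C2 :: "('a::real_normed_vector \<Rightarrow> 'b::real_normed_vector) \<Rightarrow> bool" where
  "C2 f \<longleftrightarrow> (\<exists>f' f''. has_derivatives2 f f' f'' \<and> continuous_on UNIV f'')"

definition bounded_second_derivatives ::
  "('a::real_normed_vector \<Rightarrow> 'b::real_normed_vector) \<Rightarrow> bool" where
  "bounded_second_derivatives f \<longleftrightarrow> (\<exists>f' f''. has_derivatives2 f f' f'' \<and> bounded (range f''))"

text \<open>Like \<^const>\<open>deriv\<close>, \<open>gradient f x\<close> is meaningful only where \<open>f\<close> is differentiable.\<close>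

definition gradient :: "('a::real_inner \<Rightarrow> real) \<Rightarrow> 'a \<Rightarrow> 'a" where
  "gradient f x = (SOME D. GDERIV f x :> D)"

text \<open>The supremum is taken in the extended reals, so that the equation also says that the
  supremum is finite.\<close>

definition standing_assumptions ::
  "(real^'d \<Rightarrow> real^'d \<Rightarrow> real) \<Rightarrow> (real^'d \<Rightarrow> real) \<Rightarrow> bool" where
  "standing_assumptions H G \<longleftrightarrow>
     C2 (\<lambda>(x, p). H x p) \<and> bounded_second_derivatives (\<lambda>(x, p). H x p) \<and>
     C2 G \<and> bounded_second_derivatives G \<and>
     (\<forall>x. convex_on UNIV (H x)) \<and>
     (\<exists>L :: real^'d \<Rightarrow> real^'d \<Rightarrow> real.
        C2 (\<lambda>(x, v). L x v) \<and> (\<forall>x. convex_on UNIV (L x)) \<and>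
        (\<forall>x p. ereal (H x p) = (SUP v. ereal (p \<bullet> v - L x (- v)))))"

text \<open>Solutions are total functions of \<open>(t, x)\<close>, but the conditions below only involve
  their values for \<open>t\<close> in \<open>(0, T]\<close>.\<close>

definition classical_solution ::
  "real \<Rightarrow> (real^'d \<Rightarrow> real^'d \<Rightarrow> real) \<Rightarrow> (real^'d \<Rightarrow> real) \<Rightarrow> (real \<Rightarrow> real^'d \<Rightarrow> real) \<Rightarrow> bool" where
  "classical_solution T H G u \<longleftrightarrow>
     continuous_on ({0<..T} \<times> UNIV) (\<lambda>(t, x). u t x) \<and>
     C1_on ({0<..<T} \<times> UNIV) (\<lambda>(t, x). u t x) \<and>
     (\<forall>t\<in>{0<..<T}. \<forall>x. - deriv (\<lambda>s. u s x) t + H x (gradient (u t) x) = 0) \<and>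
     (\<forall>x. u T x = G x)"

definition H_shift ::
  "real \<Rightarrow> (real^'d \<Rightarrow> real^'d \<Rightarrow> real) \<Rightarrow> real^'d \<Rightarrow> real^'d \<Rightarrow> real" where
  "H_shift \<alpha> H x p = H x (p - \<alpha> *\<^sub>R x)"

definition G_shift :: "real \<Rightarrow> (real^'d \<Rightarrow> real) \<Rightarrow> real^'d \<Rightarrow> real" where
  "G_shift \<alpha> G x = G x + \<alpha> / 2 * (norm x)\<^sup>2"

end

theory Submission
  imports Defs
begin

text \<open>
  Write \<open>q x = \<alpha> / 2 * |x|\<^sup>2\<close>. Since \<open>q\<close> is smooth and independent of time, adding it to \<open>u\<close>
  preserves the regularity of \<open>u\<close> and leaves the time derivative alone, while the spatial gradient
  becomes \<open>\<partial>\<^sub>x u + \<alpha> x\<close>. The shift in \<open>H\<^sub>\<alpha>\<close> subtracts exactly this \<open>\<alpha> x\<close>, so the two equations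
  agree pointwise, and the terminal values of both functions differ by \<open>q\<close>. This gives
  one implication for every real \<open>\<alpha>\<close>
  (lemma \<open>classical_solution_shift\<close>). The converse is the same implication for \<open>-\<alpha>\<close>, because the
  shifts by \<open>\<alpha>\<close> and \<open>-\<alpha>\<close> undo each other.

  The care needed is with the gradient: it is chosen by Hilbert's operator, so the rule
  \<open>\<partial>\<^sub>x (u + q) = \<partial>\<^sub>x u + \<alpha> x\<close> requires that \<open>u t\<close> is differentiable at \<open>x\<close>. Continuous
  differentiability of \<open>u\<close> in \<open>(t, x)\<close> jointly provides this (lemma \<open>C1_on_imp_GDERIV_slice\<close>).
\<close>

lemma gradient_eq:
  assumes "GDERIV f x :> D"
  shows "gradient f x = D"
proof -
  have "E = D" if "GDERIV f x :> E" for E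
  proof -
    have "(\<lambda>h. h \<bullet> E) = (\<lambda>h. h \<bullet> D)"
      using that assms unfolding gderiv_def by (rule has_derivative_unique)
    then show ?thesis by (metis inner_commute vector_eq_ldot)
  qed
  with assms show ?thesis
    unfolding gradient_def by (rule some_equality)
qed

lemma GDERIV_half_norm_square:
  fixes x :: "'a::real_inner"
  shows "GDERIV (\<lambda>x. \<alpha> / 2 * (norm x)\<^sup>2) x :> \<alpha> *\<^sub>R x"
  unfolding gderiv_def power2_norm_eq_inner
  by (auto intro!: derivative_eq_intros simp: inner_commute)

text \<open>Joint differentiability passes to the slice \<open>f t\<close> by the chain rule along \<open>y \<mapsto> (t, y)\<close>;
  the adjoint of the resulting functional, evaluated at \<open>1\<close>, is the vector representing it.\<close>

lemma C1_on_imp_GDERIV_slice: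
  fixes f :: "real \<Rightarrow> 'a::euclidean_space \<Rightarrow> real"
  assumes "C1_on S (\<lambda>(t, x). f t x)" and "(t, x) \<in> S"
  obtains D where "GDERIV (f t) x :> D"
proof -
  obtain A :: "(real \<times> 'a) \<Rightarrow>\<^sub>L real"
    where A: "((\<lambda>(t, x). f t x) has_derivative blinfun_apply A) (at (t, x))"
    using assms unfolding C1_on_def by blast
  have "((\<lambda>y. (t, y)) has_derivative (\<lambda>h. (0, h))) (at x)"
    by (auto intro!: derivative_eq_intros)
  from has_derivative_compose[OF this A]
  have D: "(f t has_derivative (\<lambda>h. A (0, h))) (at x)" by simp
  have "(\<lambda>h. A (0, h)) = (\<lambda>h. h \<bullet> adjoint (\<lambda>h. A (0, h)) 1)"
    using adjoint_works[OF has_derivative_linear[OF D], of _ 1] by auto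
  with D have "GDERIV (f t) x :> adjoint (\<lambda>h. A (0, h)) 1"
    unfolding gderiv_def by simp
  then show thesis by (rule that)
qed

lemma C1_on_add:
  assumes "C1_on S f" and "C1_on S g"
  shows "C1_on S (\<lambda>x. f x + g x)"
proof -
  obtain f' g' where
    "\<forall>x\<in>S. (f has_derivative blinfun_apply (f' x)) (at x)" "continuous_on S f'"
    "\<forall>x\<in>S. (g has_derivative blinfun_apply (g' x)) (at x)" "continuous_on S g'"
    using assms unfolding C1_on_def by blast
  then show ?thesis
    unfolding C1_on_def
    by (intro exI[of _ "\<lambda>x. f' x + g' x"])
       (auto simp: plus_blinfun.rep_eq intro!: has_derivative_add continuous_on_add)
qed

lemma C1_on_half_norm_square_snd:
  fixes S :: "('a::real_normed_vector \<times> 'b::real_inner) set"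
  shows "C1_on S (\<lambda>z. \<alpha> / 2 * (norm (snd z))\<^sup>2)"
  unfolding C1_on_def
proof (intro exI conjI ballI)
  let ?q' = "\<lambda>z::'a \<times> 'b. \<alpha> *\<^sub>R (blinfun_inner_right (snd z) o\<^sub>L snd_blinfun)"
  show "((\<lambda>z. \<alpha> / 2 * (norm (snd z))\<^sup>2) has_derivative blinfun_apply (?q' z)) (at z)" for z
    unfolding power2_norm_eq_inner
    by (auto intro!: derivative_eq_intros simp: inner_commute blinfun.scaleR_left)
  show "continuous_on S ?q'"
    by (intro continuous_intros bounded_linear.continuous_on[OF bounded_linear_blinfun_inner_right])
qed

lemma deriv_add_const:
  "deriv (\<lambda>s. f s + c) t = deriv f t"
proof -
  have "DERIV (\<lambda>s. f s + c) t :> D \<longleftrightarrow> DERIV f t :> D" for D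
  proof
    assume "DERIV (\<lambda>s. f s + c) t :> D"
    from DERIV_diff[OF this DERIV_const[of c]] show "DERIV f t :> D" by simp
  next
    assume "DERIV f t :> D"
    from DERIV_add[OF this DERIV_const[of c]] show "DERIV (\<lambda>s. f s + c) t :> D" by simp
  qed
  then show ?thesis by (simp add: deriv_def)
qed

lemma classical_solution_shift:
  fixes H :: "real^'d \<Rightarrow> real^'d \<Rightarrow> real"
  assumes "classical_solution T H G u"
  shows "classical_solution T (H_shift \<alpha> H) (G_shift \<alpha> G)
           (\<lambda>t x. u t x + \<alpha> / 2 * (norm x)\<^sup>2)"
proof -
  let ?q = "\<lambda>x::real^'d. \<alpha> / 2 * (norm x)\<^sup>2"
  have cont: "continuous_on ({0<..T} \<times> UNIV) (\<lambda>(t, x). u t x)"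
    and C1: "C1_on ({0<..<T} \<times> UNIV) (\<lambda>(t, x). u t x)"
    and eq: "\<And>t x. t \<in> {0<..<T} \<Longrightarrow> - deriv (\<lambda>s. u s x) t + H x (gradient (u t) x) = 0"
    and terminal: "\<And>x. u T x = G x"
    using assms unfolding classical_solution_def by auto
  have split: "(\<lambda>(t, x). u t x + ?q x) = (\<lambda>z. (\<lambda>(t, x). u t x) z + ?q (snd z))"
    by auto
  have "- deriv (\<lambda>s. u s x + ?q x) t + H_shift \<alpha> H x (gradient (\<lambda>y. u t y + ?q y) x) = 0"
    if t: "t \<in> {0<..<T}" for t x
  proof -
    obtain D where D: "GDERIV (u t) x :> D"
      using C1_on_imp_GDERIV_slice[OF C1, of t x] t by auto
    have "gradient (\<lambda>y. u t y + ?q y) x = gradient (u t) x + \<alpha> *\<^sub>R x"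
      using gradient_eq[OF D] gradient_eq[OF GDERIV_add[OF D GDERIV_half_norm_square]] by simp
    moreover have "deriv (\<lambda>s. u s x + ?q x) t = deriv (\<lambda>s. u s x) t"
      by (rule deriv_add_const)
    ultimately show ?thesis
      using eq[OF t, of x] by (simp add: H_shift_def)
  qed
  moreover have "continuous_on ({0<..T} \<times> UNIV) (\<lambda>(t, x). u t x + ?q x)"
    unfolding split by (intro continuous_intros cont)
  moreover have "C1_on ({0<..<T} \<times> UNIV) (\<lambda>(t, x). u t x + ?q x)"
    unfolding split by (intro C1_on_add C1 C1_on_half_norm_square_snd)
  ultimately show ?thesis
    unfolding classical_solution_def by (simp add: terminal G_shift_def)
qed

lemma H_shift_minus: "H_shift (-\<alpha>) (H_shift \<alpha> H) = H"
  by (simp add: H_shift_def fun_eq_iff)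

lemma G_shift_minus: "G_shift (-\<alpha>) (G_shift \<alpha> G) = G"
  by (simp add: G_shift_def fun_eq_iff)

theorem theorem1p1:
  fixes H :: "real^'d \<Rightarrow> real^'d \<Rightarrow> real"
    and G :: "real^'d \<Rightarrow> real"
    and u :: "real \<Rightarrow> real^'d \<Rightarrow> real"
    and T \<alpha> :: real
  assumes "T > 0"
    and "standing_assumptions H G"
  shows "classical_solution T H G u \<longleftrightarrow>
         classical_solution T (H_shift \<alpha> H) (G_shift \<alpha> G)
           (\<lambda>t x. u t x + \<alpha> / 2 * (norm x)\<^sup>2)"
proof
  assume "classical_solution T (H_shift \<alpha> H) (G_shift \<alpha> G) (\<lambda>t x. u t x + \<alpha> / 2 * (norm x)\<^sup>2)"
  from classical_solution_shift[OF this, of "-\<alpha>"]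
  show "classical_solution T H G u"
    by (simp add: H_shift_minus G_shift_minus)
qed (rule classical_solution_shift)

end
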